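(* Let $s\in\mathbb{N}$ and let $X=(\boldsymbol{x}_n)_{n\ge0}$ be a sequence in $[0,1)^s$ such that $m\,\widetilde{D}_m((\boldsymbol{x}_n)_{n\ge0})\le C(\log m)^s$ for all integers $m\ge 2$, where $C>0$ may depend on $s$ and on $X$ but not on $m$. Let $q\ge2$ be an integer. Then there exist constants $c_q^{(2)},c_q^{(3)}>0$, where $c_q^{(2)}$ depends only on $q$ and $c_q^{(3)}$ may also depend on $s$ and $X$, such that for all sufficiently large $N$ $$\frac{c_q^{(2)}}{\sqrt{\log N}}\le D_N((\boldsymbol{x}_{s_q(n)})_{n\ge0})\le c_q^{(3)}\frac{(\log\log N)^s}{\sqrt{\log N}}.$$
   Context: For $n\in\mathbb{N}_0$ with base-$q$ expansion $n=r_0+r_1q+r_2q^2+\cdots$, the $q$-ary sum-of-digits function is $s_q(n):=r_0+r_1+r_2+\cdots$. The discrepancy of a sequence $(\boldsymbol{y}_n)_{n\ge0}$ in $[0,1)^s$ (points counted with multiplicity) is $D_N((\boldsymbol{y}_n)):=\sup_{[\boldsymbol{a},\boldsymbol{b})\subseteq[0,1)^s}\left|\frac{\#\{0\le n<N:\boldsymbol{y}_n\in[\boldsymbol{a},\boldsymbol{b})\}}{N}-\mathrm{vol}([\boldsymbol{a},\boldsymbol{b}))\right|$. The uniform discrepancy is $\widetilde{D}_N((\boldsymbol{x}_n)_{n\ge0}):=\sup_{k\in\mathbb{N}_0}D_N((\boldsymbol{x}_{n+k})_{n\ge0})$. *)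

theory Defs
  imports Complex_Main "HOL-Library.FuncSet"
begin

text \<open>
  The dimension \<open>s\<close> has to be quantified inside the statement (one constant serves all
  dimensions), so a point of \<open>s\<close>-dimensional space is a function \<open>nat \<Rightarrow> real\<close> of which only the
  coordinates \<open>i < s\<close> matter.
\<close>

definition unit_cube :: "nat \<Rightarrow> (nat \<Rightarrow> real) set" where
  "unit_cube s = {..<s} \<rightarrow> {0..<1}"

definition box_co :: "nat \<Rightarrow> (nat \<Rightarrow> real) \<Rightarrow> (nat \<Rightarrow> real) \<Rightarrow> (nat \<Rightarrow> real) set" where
  "box_co s a b = (\<Pi> i\<in>{..<s}. {a i..<b i})"

text \<open>Only meant for \<open>a i \<le> b i\<close>.\<close>

definition box_vol :: "nat \<Rightarrow> (nat \<Rightarrow> real) \<Rightarrow> (nat \<Rightarrow> real) \<Rightarrow> real" where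
  "box_vol s a b = (\<Prod>i<s. b i - a i)"

text \<open>
  Boxes with \<open>a i = b i\<close> for some \<open>i\<close> are empty and contribute \<open>0\<close>, so admitting them does not
  affect the supremum. For \<open>N > 0\<close> all the values are at most \<open>1\<close>, hence the suprema in
  this definition and the next are genuine ones.
\<close>

definition discrepancy :: "nat \<Rightarrow> (nat \<Rightarrow> nat \<Rightarrow> real) \<Rightarrow> nat \<Rightarrow> real" where
  "discrepancy s y N =
     Sup {\<bar>real (card {n. n < N \<and> y n \<in> box_co s a b}) / real N - box_vol s a b\<bar> | a b.
            \<forall>i<s. 0 \<le> a i \<and> a i \<le> b i \<and> b i \<le> 1}"

definition uniform_discrepancy :: "nat \<Rightarrow> (nat \<Rightarrow> nat \<Rightarrow> real) \<Rightarrow> nat \<Rightarrow> real" where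
  "uniform_discrepancy s x N = (SUP k. discrepancy s (\<lambda>n. x (n + k)) N)"

text \<open>
  The \<open>i\<close>-th base-\<open>q\<close> digit of \<open>n\<close> is \<open>n div q ^ i mod q\<close>. Stopping at \<open>i = n\<close> loses nothing for
  \<open>q \<ge> 2\<close>, because then \<open>n < q ^ i\<close> for all \<open>i \<ge> n\<close>.
\<close>

definition digit_sum :: "nat \<Rightarrow> nat \<Rightarrow> nat" where
  "digit_sum q n = (\<Sum>i\<le>n. n div q ^ i mod q)"

end

theory Submission
  imports Defs "HOL-Analysis.Analysis" "HOL-Computational_Algebra.Polynomial"
begin

text \<open>
  Let \<open>G\<^sub>N(x) = \<Sum>n<N. x ^ s\<^sub>q(n)\<close> and \<open>P(x) = 1 + x + \<dots> + x ^ (q - 1)\<close>, so that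
  the \<open>j\<close>-th coefficient of \<open>G\<^sub>N\<close> counts the \<open>n < N\<close> with digit sum \<open>j\<close>.
  For the upper bound, Abel summation reduces the discrepancy of \<open>x\<close> along \<open>s\<^sub>q\<close> to the discrepancy
  of initial segments of \<open>x\<close> of length \<open>O(log N)\<close>, weighted by the \<open>\<ell>\<^sup>1\<close> norm of
  \<open>(1 - x) G\<^sub>N(x)\<close>. Writing \<open>N = q^i M + r\<close> with \<open>q^i\<close> about \<open>sqrt N\<close> splits off a factor \<open>P^i\<close>
  from \<open>G\<^sub>N\<close>, up to \<open>r\<close> terms, and \<open>(1 - x) P^i\<close> has norm \<open>O(q^i / sqrt i)\<close>.
  For the lower bound, the digit sum of \<open>n < q^i\<close> has variance \<open>O(i)\<close>, so by Chebyshev and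
  pigeonhole one value \<open>j\<close> has frequency at least a constant times \<open>1 / sqrt i\<close>, and a tiny box
  around the \<open>j\<close>-th point shows that the discrepancy is at least half of it.
\<close>

section \<open>The coefficient norm of real polynomials\<close>

definition l1_norm :: "real poly \<Rightarrow> real" where
  "l1_norm p = (\<Sum>j\<le>degree p. \<bar>coeff p j\<bar>)"

lemma l1_norm_eq:
  assumes "degree p \<le> n"
  shows "l1_norm p = (\<Sum>j\<le>n. \<bar>coeff p j\<bar>)"
  unfolding l1_norm_def
  by (rule sum.mono_neutral_left) (use assms in \<open>auto simp: coeff_eq_0 not_le\<close>)

lemma l1_norm_nonneg: "0 \<le> l1_norm p"
  by (simp add: l1_norm_def sum_nonneg)

lemma l1_norm_0 [simp]: "l1_norm 0 = 0"
  by (simp add: l1_norm_def)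

lemma l1_norm_pCons: "l1_norm (pCons a p) = \<bar>a\<bar> + l1_norm p"
proof -
  have "l1_norm (pCons a p) = (\<Sum>j\<le>Suc (degree p). \<bar>coeff (pCons a p) j\<bar>)"
    by (rule l1_norm_eq) (rule degree_pCons_le)
  then show ?thesis
    unfolding sum.atMost_Suc_shift by (simp add: l1_norm_def)
qed

lemma l1_norm_smult: "l1_norm (smult c p) = \<bar>c\<bar> * l1_norm p"
  by (subst l1_norm_eq[OF degree_smult_le]) (simp add: l1_norm_def abs_mult sum_distrib_left)

lemma l1_norm_add_le: "l1_norm (p + r) \<le> l1_norm p + l1_norm r"
proof -
  define n where "n = max (degree p) (degree r)"
  have "l1_norm (p + r) = (\<Sum>j\<le>n. \<bar>coeff (p + r) j\<bar>)"
    by (rule l1_norm_eq) (simp add: n_def degree_add_le)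
  also have "\<dots> \<le> (\<Sum>j\<le>n. \<bar>coeff p j\<bar> + \<bar>coeff r j\<bar>)"
    by (rule sum_mono) simp
  also have "\<dots> = l1_norm p + l1_norm r"
    by (simp add: l1_norm_eq[of _ n] n_def sum.distrib)
  finally show ?thesis .
qed

lemma l1_norm_sum_le: "l1_norm (sum f A) \<le> (\<Sum>x\<in>A. l1_norm (f x))"
proof (induction A rule: infinite_finite_induct)
  case (insert x A)
  then show ?case using l1_norm_add_le[of "f x" "sum f A"] by simp
qed simp_all

lemma l1_norm_mult_le: "l1_norm (p * r) \<le> l1_norm p * l1_norm r"
proof (induction p)
  case (pCons a p)
  have "l1_norm (pCons a p * r) \<le> l1_norm (smult a r) + l1_norm (pCons 0 (p * r))"
    by (simp add: l1_norm_add_le)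
  also have "\<dots> \<le> \<bar>a\<bar> * l1_norm r + l1_norm p * l1_norm r"
    using pCons.IH by (simp add: l1_norm_smult l1_norm_pCons)
  finally show ?case by (simp add: l1_norm_pCons algebra_simps)
qed simp

lemma l1_norm_power_le: "l1_norm (p ^ n) \<le> l1_norm p ^ n"
proof (induction n)
  case 0
  show ?case by (simp add: l1_norm_def)
next
  case (Suc n)
  have "l1_norm (p ^ Suc n) \<le> l1_norm p * l1_norm (p ^ n)"
    using l1_norm_mult_le by simp
  also have "\<dots> \<le> l1_norm p * l1_norm p ^ n"
    by (intro mult_left_mono Suc.IH l1_norm_nonneg)
  finally show ?case by simp
qed

lemma l1_norm_monom: "l1_norm (monom c n) = \<bar>c\<bar>"
  by (induction n) (simp_all add: monom_0 monom_Suc l1_norm_pCons)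

section \<open>Binomial deviations and the norm of \<open>(1 - x) (1 + x)^k\<close>\<close>

text \<open>Up to the factor \<open>4 * 2 ^ n\<close> this is the variance \<open>n / 4\<close> of
  \<open>n\<close> fair coins, read off from the Bernstein moments at \<open>1/2\<close>.\<close>

lemma sum_binomial_deviation_sq:
  "(\<Sum>j\<le>n. real (n choose j) * (real n - 2 * real j)\<^sup>2) = real n * 2 ^ n"
proof -
  have B: "real (n choose j) = 2 ^ n * Bernstein n j (1/2)" if "j \<le> n" for j
  proof -
    have "2 ^ n * ((1/2) ^ j * (1/2) ^ (n - j)) = (1::real)"
      using that by (simp add: power_divide flip: power_add)
    then show ?thesis by (simp add: Bernstein_def mult_ac)
  qed
  \<comment> \<open>The square is expanded in \<open>1\<close>, \<open>j\<close> and
    \<open>j (j - 1)\<close>, the factorial moments that have closed Bernstein sums.\<close>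
  have "(\<Sum>j\<le>n. real (n choose j) * (real n - 2 * real j)\<^sup>2)
      = (\<Sum>j\<le>n. 2 ^ n * ((real n)\<^sup>2 * Bernstein n j (1/2) + (4 - 4 * real n) * (real j * Bernstein n j (1/2))
            + 4 * (real j * (real j - 1) * Bernstein n j (1/2))))"
    by (rule sum.cong) (simp_all add: B power2_eq_square algebra_simps)
  also have "\<dots> = 2 ^ n * ((real n)\<^sup>2 + (4 - 4 * real n) * (real n * (1/2)) + 4 * (real n * (real n - 1) * (1/2)\<^sup>2))"
    by (simp only: sum.distrib sum_distrib_left[symmetric] sum_k_Bernstein sum_kk_Bernstein sum_Bernstein) simp
  also have "\<dots> = real n * 2 ^ n"
    by (simp add: power2_eq_square algebra_simps)
  finally show ?thesis .
qed

text \<open>Cauchy-Schwarz against the variance, with each binomial weight split into two square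
  roots.\<close>

lemma sum_binomial_abs_deviation_le:
  "(\<Sum>j\<le>n. real (n choose j) * \<bar>real n - 2 * real j\<bar>) \<le> sqrt (real n) * 2 ^ n"
proof (rule power2_le_imp_le)
  have "(\<Sum>j\<le>n. real (n choose j) * \<bar>real n - 2 * real j\<bar>)\<^sup>2
      = (\<Sum>j\<le>n. sqrt (real (n choose j)) * (sqrt (real (n choose j)) * \<bar>real n - 2 * real j\<bar>))\<^sup>2"
    by (simp flip: mult.assoc)
  also have "\<dots> \<le> (\<Sum>j\<le>n. (sqrt (real (n choose j)))\<^sup>2)
      * (\<Sum>j\<le>n. (sqrt (real (n choose j)) * \<bar>real n - 2 * real j\<bar>)\<^sup>2)"
    by (rule Cauchy_Schwarz_ineq_sum)
  also have "\<dots> = (\<Sum>j\<le>n. real (n choose j)) * (real n * 2 ^ n)"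
    by (simp add: power_mult_distrib sum_binomial_deviation_sq)
  also have "\<dots> = (sqrt (real n) * 2 ^ n)\<^sup>2"
    using choose_row_sum[of n] by (simp add: power2_eq_square flip: of_nat_sum)
  finally show "(\<Sum>j\<le>n. real (n choose j) * \<bar>real n - 2 * real j\<bar>)\<^sup>2 \<le> (sqrt (real n) * 2 ^ n)\<^sup>2" .
qed simp

text \<open>Coefficientwise, \<open>(k + 1) (1 - x) (1 + x)^k\<close> is the score \<open>k + 1 - 2 j\<close> times the
  binomial coefficient, so its norm is a mean absolute deviation.\<close>

lemma l1_norm_diff_binomial_le:
  "l1_norm ([:1, -1:] * [:1, 1:] ^ k) \<le> 2 ^ Suc k / sqrt (real (Suc k))"
proof -
  have c: "coeff ([:1, 1:] ^ m) j = real (m choose j)" for m j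
  proof (cases "j \<le> m")
    case False
    have "degree ([:1, 1::real:] ^ m) \<le> m"
      using degree_power_le[of "[:1, 1::real:]" m] by simp
    with False show ?thesis by (simp add: coeff_eq_0)
  qed (simp add: coeff_linear_poly_power)
  have "real (Suc k) * \<bar>coeff ([:1, -1:] * [:1, 1:] ^ k) j\<bar>
      = real (Suc k choose j) * \<bar>real (Suc k) - 2 * real j\<bar>" for j
  proof (cases j)
    case (Suc i)
    \<comment> \<open>Pascal's rule rewrites the coefficient as
      \<open>(Suc k choose j) - 2 (k choose i)\<close>; absorption turns
      \<open>Suc k * (k choose i)\<close> into \<open>j * (Suc k choose j)\<close>.\<close>
    have 1: "real (Suc i) * real (Suc k choose Suc i) = real (Suc k) * real (k choose i)"
      using Suc_times_binomial_eq[of k i] by (simp only: flip: of_nat_mult) (simp add: mult.commute)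
    have 2: "real (Suc k choose Suc i) = real (k choose i) + real (k choose Suc i)"
      by simp
    have "real (Suc k) * coeff ([:1, -1:] * [:1, 1:] ^ k) j
        = real (Suc k) * (real (k choose Suc i) - real (k choose i))"
      by (simp add: Suc c)
    also have "\<dots> = real (Suc k choose j) * (real (Suc k) - 2 * real j)"
      using 1 unfolding Suc 2 by (simp only: algebra_simps)
    finally show ?thesis by (metis abs_mult abs_of_nat)
  qed (simp add: c)
  note E = this
  have d: "degree ([:1, -1:] * [:1, 1::real:] ^ k) \<le> Suc k"
    using degree_mult_le[of "[:1, -1:]" "[:1, 1::real:] ^ k"] degree_power_le[of "[:1, 1::real:]" k]
    by simp
  have "real (Suc k) * l1_norm ([:1, -1:] * [:1, 1:] ^ k)
      = (\<Sum>j\<le>Suc k. real (Suc k choose j) * \<bar>real (Suc k) - 2 * real j\<bar>)"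
    unfolding l1_norm_eq[OF d] sum_distrib_left E ..
  also have "\<dots> \<le> sqrt (real (Suc k)) * 2 ^ Suc k"
    by (rule sum_binomial_abs_deviation_le)
  also have "\<dots> = real (Suc k) * (2 ^ Suc k / sqrt (real (Suc k)))"
    using real_div_sqrt[of "real (Suc k)"] by (metis times_divide_eq_left times_divide_eq_right of_nat_0_le_iff)
  finally show ?thesis
    by (subst (asm) mult_le_cancel_left_pos) auto
qed

section \<open>The norm of \<open>(1 - x) P^i\<close> for the digit polynomial
  \<open>P\<close>\<close>

text \<open>The weights are \<open>(r + 2) ^ i\<close> times a binomial distribution with success
  probability \<open>2 / (r + 2)\<close>. Cauchy-Schwarz reduces the mean of
  \<open>1 / sqrt (k + 1)\<close> to that of \<open>1 / (k + 1)\<close>, which absorption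
  controls.\<close>

lemma sum_binomial_mean_inverse_sqrt_le:
  fixes r :: real
  assumes "r \<ge> 0"
  shows "(\<Sum>k\<le>i. real (i choose k) * 2 ^ k * r ^ (i - k) / sqrt (real (Suc k)))
    \<le> (r + 2) ^ i * sqrt ((r + 2) / (2 * real (Suc i)))"
proof (rule power2_le_imp_le)
  define w where "w k = real (i choose k) * 2 ^ k * r ^ (i - k)" for k
  have w: "w k \<ge> 0" for k using assms by (simp add: w_def)
  have sw: "sum w {..i} = (r + 2) ^ i"
    using binomial_ring[of 2 r i] by (simp add: w_def add.commute)
  have "2 * real (Suc i) * (\<Sum>k\<le>i. w k / real (Suc k))
      = (\<Sum>k\<le>i. real (Suc i choose Suc k) * 2 ^ Suc k * r ^ (Suc i - Suc k))"
  proof -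
    have "2 * real (Suc i) * (w k / real (Suc k))
        = real (Suc i choose Suc k) * 2 ^ Suc k * r ^ (Suc i - Suc k)" for k
    proof -
      have "real (Suc k) * real (Suc i choose Suc k) = real (Suc i) * real (i choose k)"
        using Suc_times_binomial_eq[of i k] by (simp only: flip: of_nat_mult) (simp add: mult.commute)
      then have "real (Suc i choose Suc k) = real (Suc i) * real (i choose k) / real (Suc k)"
        by (simp only: field_simps)
      then show ?thesis unfolding w_def by simp
    qed
    then show ?thesis by (simp only: sum_distrib_left)
  qed
  \<comment> \<open>Only the nonnegative term \<open>k = 0\<close> is missing from the full binomial
    row.\<close>
  also have "\<dots> \<le> (\<Sum>k\<le>Suc i. real (Suc i choose k) * 2 ^ k * r ^ (Suc i - k))"
    unfolding sum.atMost_Suc_shift using assms by simp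
  also have "\<dots> = (r + 2) ^ Suc i"
    using binomial_ring[of 2 r "Suc i"] by (simp only: add.commute of_nat_numeral)
  finally have S: "(\<Sum>k\<le>i. w k / real (Suc k)) \<le> (r + 2) ^ Suc i / (2 * real (Suc i))"
    by (simp del: of_nat_Suc add: pos_le_divide_eq mult_ac)
  have "(\<Sum>k\<le>i. real (i choose k) * 2 ^ k * r ^ (i - k) / sqrt (real (Suc k)))\<^sup>2
      = (\<Sum>k\<le>i. sqrt (w k) * sqrt (w k / real (Suc k)))\<^sup>2"
  proof -
    have "w k / sqrt (real (Suc k)) = sqrt (w k) * sqrt (w k / real (Suc k))" for k
      using w[of k] by (simp add: real_sqrt_divide)
    then show ?thesis unfolding w_def by simp
  qed
  also have "\<dots> \<le> (\<Sum>k\<le>i. (sqrt (w k))\<^sup>2) * (\<Sum>k\<le>i. (sqrt (w k / real (Suc k)))\<^sup>2)"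
    by (rule Cauchy_Schwarz_ineq_sum)
  also have "\<dots> = (r + 2) ^ i * (\<Sum>k\<le>i. w k / real (Suc k))"
    using w sw by (simp add: divide_nonneg_nonneg)
  also have "\<dots> \<le> (r + 2) ^ i * ((r + 2) ^ Suc i / (2 * real (Suc i)))"
    by (intro mult_left_mono S) (use assms in simp)
  also have "\<dots> = ((r + 2) ^ i * sqrt ((r + 2) / (2 * real (Suc i))))\<^sup>2"
    by (subst power_mult_distrib, subst real_sqrt_pow2) (use assms in \<open>simp_all add: power2_eq_square\<close>)
  finally show "(\<Sum>k\<le>i. real (i choose k) * 2 ^ k * r ^ (i - k) / sqrt (real (Suc k)))\<^sup>2
     \<le> ((r + 2) ^ i * sqrt ((r + 2) / (2 * real (Suc i))))\<^sup>2" .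
qed (use assms in simp)

definition digit_poly :: "nat \<Rightarrow> real poly" where
  "digit_poly q = (\<Sum>c<q. monom 1 c)"

text \<open>A uniform digit is a mixture: with probability \<open>2 / q\<close> it is a fair coin in \<open>{0, 1}\<close>.
  Conditionally on the number of coins the binomial estimate applies.\<close>

lemma l1_norm_diff_digit_poly_power_le:
  assumes "q \<ge> 2"
  shows "l1_norm ([:1, -1:] * digit_poly q ^ i) \<le> 2 * real q ^ i * sqrt (real q / (2 * real (Suc i)))"
proof -
  \<comment> \<open>\<open>R\<close> carries the digits outside the coin; for \<open>q = 2\<close>
    it is \<open>0\<close>.\<close>
  define R :: "real poly" where "R = (\<Sum>c\<in>{2..<q}. monom 1 c)"
  define r where "r = real q - 2"
  have r: "r \<ge> 0" "r + 2 = real q" using assms by (auto simp: r_def)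
  have "{..<q} = {0, 1} \<union> {2..<q}" using assms by auto
  then have "digit_poly q = (\<Sum>c\<in>{0, 1}. monom 1 c) + R"
    unfolding digit_poly_def R_def by (simp only:) (rule sum.union_disjoint, auto)
  then have P: "digit_poly q = [:1, 1:] + R"
    by (simp add: monom_0 monom_Suc one_pCons)
  have "l1_norm R \<le> r"
    using l1_norm_sum_le[of "monom 1" "{2..<q}"] assms by (simp add: R_def r_def l1_norm_monom of_nat_diff)
  then have R: "l1_norm (R ^ m) \<le> r ^ m" for m
    using l1_norm_power_le[of R m] power_mono[of "l1_norm R" r m] l1_norm_nonneg[of R] by linarith
  \<comment> \<open>Here \<open>k\<close> counts the digits supplied by the coin part
    \<open>1 + x\<close>.\<close>
  have "[:1, -1:] * digit_poly q ^ i
      = (\<Sum>k\<le>i. smult (real (i choose k)) ([:1, -1:] * [:1, 1:] ^ k * R ^ (i - k)))"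
    unfolding P binomial_ring sum_distrib_left by (intro sum.cong) (simp_all add: of_nat_poly mult_ac)
  also have "l1_norm \<dots> \<le> (\<Sum>k\<le>i. real (i choose k) * l1_norm ([:1, -1:] * [:1, 1:] ^ k * R ^ (i - k)))"
    by (rule order_trans[OF l1_norm_sum_le]) (simp add: l1_norm_smult)
  also have "\<dots> \<le> (\<Sum>k\<le>i. real (i choose k) * (2 ^ Suc k / sqrt (real (Suc k)) * r ^ (i - k)))"
    by (intro sum_mono mult_left_mono order_trans[OF l1_norm_mult_le] mult_mono
        l1_norm_diff_binomial_le R) (auto simp: l1_norm_nonneg)
  also have "\<dots> = 2 * (\<Sum>k\<le>i. real (i choose k) * 2 ^ k * r ^ (i - k) / sqrt (real (Suc k)))"
    unfolding sum_distrib_left by (intro sum.cong) (simp_all add: mult_ac)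
  also have "\<dots> \<le> 2 * ((r + 2) ^ i * sqrt ((r + 2) / (2 * real (Suc i))))"
    by (intro mult_left_mono sum_binomial_mean_inverse_sqrt_le r) simp
  finally show ?thesis by (simp add: r(2))
qed

section \<open>Digit sums and their generating polynomial\<close>

text \<open>The two ranges differ only in vanishing digits, so the cut-off in the definition can be
  traded for any sufficient number of digits.\<close>

lemma digit_sum_eq_sum_lessThan:
  assumes "q \<ge> 2" "n < q ^ k"
  shows "digit_sum q n = (\<Sum>i<k. n div q ^ i mod q)"
proof -
  have "n div q ^ i = 0" if "n < i" for i
  proof -
    have "n < 2 ^ i" using that less_exp[of i] by linarith
    also have "(2::nat) ^ i \<le> q ^ i" using assms(1) by (rule power_mono) simp
    finally show ?thesis by simp
  qed
  moreover have "n div q ^ i = 0" if "k \<le> i" for i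
    using assms power_increasing[OF that, of q] by (intro div_less) linarith
  ultimately show ?thesis
    unfolding digit_sum_def by (intro sum.mono_neutral_cong) auto
qed

text \<open>Appending a last digit shifts the others by one place. Both the product formula for the
  generating polynomial and the variance recursion rest on this.\<close>

lemma digit_sum_mult_add:
  assumes "q \<ge> 2" "c < q"
  shows "digit_sum q (q * m + c) = digit_sum q m + c"
proof -
  have m: "m < q ^ m"
    using less_exp[of m] power_mono[of 2 q m] assms(1) by linarith
  have "q * m + c < q * Suc m"
    using assms(2) by simp
  also have "\<dots> \<le> q ^ Suc m"
    using m by (simp only: power_Suc mult_le_mono2 Suc_leI)
  finally have "digit_sum q (q * m + c) = (\<Sum>i<Suc m. (q * m + c) div q ^ i mod q)"
    by (rule digit_sum_eq_sum_lessThan[OF assms(1)])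
  also have "\<dots> = c + (\<Sum>i<m. (q * m + c) div q ^ Suc i mod q)"
    unfolding sum.lessThan_Suc_shift using assms(2) by simp
  also have "(\<Sum>i<m. (q * m + c) div q ^ Suc i mod q) = (\<Sum>i<m. m div q ^ i mod q)"
    using assms by (simp add: div_mult2_eq)
  also have "\<dots> = digit_sum q m"
    by (rule digit_sum_eq_sum_lessThan[OF assms(1) m, symmetric])
  finally show ?thesis by simp
qed

text \<open>Digit sums below \<open>N\<close> are thus \<open>O(log N)\<close>, which limits how
  much of the original sequence is visited.\<close>

lemma digit_sum_le:
  assumes "q \<ge> 2" "n < q ^ k"
  shows "digit_sum q n \<le> q * k"
proof -
  have "n div q ^ i mod q \<le> q" for i
    using assms(1) by (intro less_imp_le mod_less_divisor) simp
  then have "(\<Sum>i<k. n div q ^ i mod q) \<le> (\<Sum>i<k. q)"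
    by (rule sum_mono)
  with assms show ?thesis by (simp add: digit_sum_eq_sum_lessThan mult.commute)
qed

lemma sum_lessThan_mult:
  fixes f :: "nat \<Rightarrow> 'a::comm_monoid_add"
  shows "(\<Sum>n<q * m. f n) = (\<Sum>k<m. \<Sum>c<q. f (q * k + c))"
proof -
  have "(\<Sum>n<q * m. f n) = (\<Sum>k<m. sum f {k * q..<k * q + q})"
    by (simp add: sum.nat_group mult.commute)
  also have "\<dots> = (\<Sum>k<m. \<Sum>c<q. f (q * k + c))"
  proof (rule sum.cong[OF refl])
    fix k
    show "sum f {k * q..<k * q + q} = (\<Sum>c<q. f (q * k + c))"
      by (rule sum.reindex_bij_witness[of _ "\<lambda>c. q * k + c" "\<lambda>n. n - q * k"])
        (auto simp: mult.commute)
  qed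
  finally show ?thesis .
qed

definition digit_sum_poly :: "nat \<Rightarrow> nat \<Rightarrow> real poly" where
  "digit_sum_poly q N = (\<Sum>n<N. monom 1 (digit_sum q n))"

text \<open>The last digit varies independently of the remaining ones, so generating polynomials
  multiply.\<close>

lemma digit_sum_poly_mult:
  assumes "q \<ge> 2"
  shows "digit_sum_poly q (q * M) = digit_poly q * digit_sum_poly q M"
proof -
  have "digit_sum_poly q (q * M) = (\<Sum>k<M. \<Sum>c<q. monom 1 c * monom 1 (digit_sum q k))"
    unfolding digit_sum_poly_def sum_lessThan_mult
    by (intro sum.cong refl, subst digit_sum_mult_add) (auto simp: assms mult_monom add.commute)
  then show ?thesis
    by (simp add: digit_sum_poly_def digit_poly_def flip: sum_distrib_left sum_distrib_right)
qed

lemma digit_sum_poly_power_mult: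
  assumes "q \<ge> 2"
  shows "digit_sum_poly q (q ^ i * M) = digit_poly q ^ i * digit_sum_poly q M"
  by (induction i) (simp_all add: digit_sum_poly_mult[OF assms] mult.assoc)

text \<open>Cancellation comes from complete blocks of length \<open>q ^ i\<close>, giving the first
  summand of the constant. The incomplete block is bounded trivially; the summand \<open>2\<close>
  is the norm of \<open>1 - x\<close>.\<close>

lemma l1_norm_diff_digit_sum_poly_le:
  assumes "q \<ge> 2" "q ^ (2 * i) \<le> N"
  shows "l1_norm ([:1, -1:] * digit_sum_poly q N)
    \<le> (2 * sqrt (real q / 2) + 2) * (real N / sqrt (real (Suc i)))"
proof -
  define M r where "M = N div q ^ i" and "r = N mod q ^ i"
  have N: "N = q ^ i * M + r" by (simp add: M_def r_def)
  have r: "r < q ^ i" using assms(1) by (simp add: r_def)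
  define R :: "real poly" where "R = (\<Sum>n\<in>{q ^ i * M..<N}. monom 1 (digit_sum q n))"
  have "digit_sum_poly q N = digit_sum_poly q (q ^ i * M) + R"
    unfolding digit_sum_poly_def R_def lessThan_atLeast0
    by (rule sum.atLeastLessThan_concat[symmetric]) (simp_all add: M_def)
  then have split: "[:1, -1:] * digit_sum_poly q N
      = [:1, -1:] * digit_poly q ^ i * digit_sum_poly q M + [:1, -1:] * R"
    by (simp only: digit_sum_poly_power_mult[OF assms(1)] distrib_left mult.assoc)
  have 1: "l1_norm ([:1, -1:] * digit_sum_poly q N)
      \<le> l1_norm ([:1, -1:] * digit_poly q ^ i) * l1_norm (digit_sum_poly q M)
        + l1_norm [:1, -1:] * l1_norm R"
    unfolding split by (rule order_trans[OF l1_norm_add_le add_mono[OF l1_norm_mult_le l1_norm_mult_le]])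
  have "l1_norm R \<le> real r"
    unfolding R_def by (rule order_trans[OF l1_norm_sum_le]) (simp add: l1_norm_monom N)
  then have 2: "l1_norm [:1, -1:] * l1_norm R \<le> 2 * real r"
    by (simp add: l1_norm_pCons)
  have "l1_norm (digit_sum_poly q M) \<le> real M"
    unfolding digit_sum_poly_def by (rule order_trans[OF l1_norm_sum_le]) (simp add: l1_norm_monom)
  then have "l1_norm ([:1, -1:] * digit_poly q ^ i) * l1_norm (digit_sum_poly q M)
      \<le> 2 * real q ^ i * sqrt (real q / (2 * real (Suc i))) * real M"
    by (intro mult_mono l1_norm_diff_digit_poly_power_le assms(1)) (simp_all add: l1_norm_nonneg)
  also have "\<dots> = real (q ^ i * M) * (2 * sqrt (real q / 2) / sqrt (real (Suc i)))"
    by (simp del: of_nat_Suc add: real_sqrt_divide real_sqrt_mult)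
  also have "\<dots> \<le> real N * (2 * sqrt (real q / 2) / sqrt (real (Suc i)))"
    by (intro mult_right_mono) (simp_all add: N del: of_nat_mult of_nat_add)
  finally have 3: "l1_norm ([:1, -1:] * digit_poly q ^ i) * l1_norm (digit_sum_poly q M)
      \<le> 2 * sqrt (real q / 2) * (real N / sqrt (real (Suc i)))"
    by (simp add: mult_ac)
  \<comment> \<open>Since \<open>sqrt (i + 1)\<close> and \<open>r\<close> are both at most
    \<open>q ^ i\<close>, their product is at most \<open>q ^ (2 * i)\<close>, hence at most
    \<open>N\<close>.\<close>
  have "Suc i \<le> q ^ i"
    using less_exp[of i] power_mono[of 2 q i] assms(1) by linarith
  then have "real (Suc i) \<le> real (q ^ i)"
    by (simp only: of_nat_le_iff)
  moreover have "sqrt (real (Suc i)) \<le> real (Suc i)"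
    by (rule real_le_lsqrt) (simp_all add: power2_eq_square)
  ultimately have "sqrt (real (Suc i)) \<le> real (q ^ i)"
    by linarith
  then have "real r * sqrt (real (Suc i)) \<le> real (q ^ i) * real (q ^ i)"
    using r by (intro mult_mono) simp_all
  also have "\<dots> \<le> real N"
    using assms(2) by (simp only: of_nat_mult[symmetric] of_nat_le_iff power_add[symmetric] mult_2)
  finally have 4: "real r \<le> real N / sqrt (real (Suc i))"
    by (simp add: pos_le_divide_eq)
  show ?thesis using 1 2 3 4 unfolding distrib_right by linarith
qed

section \<open>Abel summation\<close>

lemma sum_abs_coeff_le_l1_norm: "(\<Sum>j\<le>n. \<bar>coeff p j\<bar>) \<le> l1_norm p"
proof -
  have "(\<Sum>j\<le>n. \<bar>coeff p j\<bar>) \<le> (\<Sum>j\<le>max n (degree p). \<bar>coeff p j\<bar>)"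
    by (rule sum_mono2) auto
  then show ?thesis by (simp add: l1_norm_eq[of p "max n (degree p)"])
qed

text \<open>Abel summation: pairing a polynomial with \<open>F\<close> coefficientwise, multiplication by \<open>1 - x\<close>
  turns into the difference operator on \<open>F\<close>.\<close>

lemma abs_sum_difference_le_l1_norm:
  assumes "\<And>n. n < N \<Longrightarrow> u n \<le> J" "\<And>j. j \<le> Suc J \<Longrightarrow> \<bar>F j\<bar> \<le> B"
  shows "\<bar>\<Sum>n<N. F (Suc (u n)) - F (u n)\<bar> \<le> l1_norm ([:1, -1:] * (\<Sum>n<N. monom 1 (u n))) * B"
proof -
  \<comment> \<open>\<open>(1 - x) x^k\<close> has degree \<open>k + 1\<close>, so the index must
    run up to \<open>Suc J\<close>.\<close>
  have D: "F k - F (Suc k) = (\<Sum>j\<le>Suc J. coeff ([:1, -1:] * monom 1 k) j * F j)" if "k \<le> J" for k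
  proof -
    have "coeff ([:1, -1:] * monom (1::real) k) j * F j
        = (if j = k then F j else 0) - (if j = Suc k then F j else 0)" for j
      by (auto simp: coeff_pCons split: nat.splits)
    then show ?thesis using that by (simp only: sum_subtractf) (simp add: sum.delta)
  qed
  have "(\<Sum>n<N. F (u n) - F (Suc (u n)))
      = (\<Sum>n<N. \<Sum>j\<le>Suc J. coeff ([:1, -1:] * monom 1 (u n)) j * F j)"
    by (intro sum.cong refl D assms(1)) simp
  also have "\<dots> = (\<Sum>j\<le>Suc J. coeff ([:1, -1:] * (\<Sum>n<N. monom 1 (u n))) j * F j)"
    by (subst sum.swap) (simp only: sum_distrib_left coeff_sum sum_distrib_right)
  also have "\<bar>\<dots>\<bar> \<le> (\<Sum>j\<le>Suc J. \<bar>coeff ([:1, -1:] * (\<Sum>n<N. monom 1 (u n))) j\<bar> * B)"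
    by (rule order_trans[OF sum_abs], rule sum_mono, unfold abs_mult, rule mult_left_mono) (auto simp: assms(2))
  \<comment> \<open>The instance \<open>j = 0\<close> of the bound on \<open>F\<close> supplies
    \<open>B >= 0\<close>.\<close>
  also have "\<dots> \<le> l1_norm ([:1, -1:] * (\<Sum>n<N. monom 1 (u n))) * B"
    unfolding sum_distrib_right[symmetric] using assms(2)[of 0]
    by (intro mult_right_mono sum_abs_coeff_le_l1_norm) simp
  finally have "\<bar>\<Sum>n<N. F (u n) - F (Suc (u n))\<bar> \<le> l1_norm ([:1, -1:] * (\<Sum>n<N. monom 1 (u n))) * B" .
  then show ?thesis by (simp only: sum_subtractf abs_minus_commute)
qed

section \<open>Concentration of the digit sum\<close>

text \<open>Variances of independent digits add up. A digit has mean \<open>(q - 1) / 2\<close> and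
  variance at most \<open>q^2\<close>.\<close>

lemma sum_digit_deviation_sq_le:
  assumes "q \<ge> 2"
  shows "(\<Sum>n<q ^ i. (real (digit_sum q n) - real i * ((real q - 1) / 2))\<^sup>2) \<le> real i * real q ^ i * (real q)\<^sup>2"
proof (induction i)
  case 0
  show ?case by (simp add: digit_sum_def)
next
  case (Suc i)
  define \<mu> where "\<mu> = (real q - 1) / 2"
  define d where "d n = real (digit_sum q n) - real i * \<mu>" for n
  have "2 * (\<Sum>c<m. real c) = real m * (real m - 1)" for m
    by (induction m) (auto simp: algebra_simps)
  from this[of q] have "(\<Sum>c<q. real c) = real q * \<mu>"
    by (simp add: \<mu>_def field_simps)
  \<comment> \<open>Centring makes the cross term of the square vanish below.\<close>
  then have c0: "(\<Sum>c<q. real c - \<mu>) = 0"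
    by (simp add: sum_subtractf)
  have "(real c - \<mu>)\<^sup>2 \<le> (real q)\<^sup>2" if "c < q" for c
  proof -
    have "0 \<le> real c" "real c < real q" "1 \<le> real q" using that assms by simp_all
    then have "- real q \<le> real c - \<mu>" "real c - \<mu> \<le> real q"
      by (simp_all add: \<mu>_def field_simps)
    then have "\<bar>real c - \<mu>\<bar> \<le> \<bar>real q\<bar>" by simp
    then show ?thesis by (simp only: abs_le_square_iff)
  qed
  then have "(\<Sum>c<q. (real c - \<mu>)\<^sup>2) \<le> (\<Sum>c<q. (real q)\<^sup>2)"
    by (intro sum_mono) simp
  then have c2: "(\<Sum>c<q. (real c - \<mu>)\<^sup>2) \<le> real q * (real q)\<^sup>2" by simp
  have "(\<Sum>n<q ^ Suc i. (real (digit_sum q n) - real (Suc i) * \<mu>)\<^sup>2)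
      = (\<Sum>k<q ^ i. \<Sum>c<q. (d k + (real c - \<mu>))\<^sup>2)"
    unfolding power_Suc sum_lessThan_mult
    by (intro sum.cong refl, subst digit_sum_mult_add) (auto simp: assms d_def algebra_simps)
  also have "\<dots> = (\<Sum>k<q ^ i. real q * (d k)\<^sup>2 + (\<Sum>c<q. (real c - \<mu>)\<^sup>2))"
  proof (intro sum.cong refl)
    fix k
    have "(\<Sum>c<q. (d k + (real c - \<mu>))\<^sup>2)
        = (\<Sum>c<q. (d k)\<^sup>2 + (real c - \<mu>)\<^sup>2 + 2 * d k * (real c - \<mu>))"
      by (intro sum.cong refl) (rule power2_sum)
    also have "\<dots> = real q * (d k)\<^sup>2 + (\<Sum>c<q. (real c - \<mu>)\<^sup>2)"
      by (simp only: sum.distrib sum_distrib_left[symmetric] c0) simp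
    finally show "(\<Sum>c<q. (d k + (real c - \<mu>))\<^sup>2) = \<dots>" .
  qed
  also have "\<dots> \<le> (\<Sum>k<q ^ i. real q * (d k)\<^sup>2 + real q * (real q)\<^sup>2)"
    by (intro sum_mono add_left_mono c2)
  also have "\<dots> = real q * (\<Sum>k<q ^ i. (d k)\<^sup>2) + real q ^ Suc i * (real q)\<^sup>2"
    by (simp add: sum.distrib sum_distrib_left)
  also have "\<dots> \<le> real q * (real i * real q ^ i * (real q)\<^sup>2) + real q ^ Suc i * (real q)\<^sup>2"
    using Suc.IH by (intro add_right_mono mult_left_mono) (simp_all add: d_def \<mu>_def)
  also have "\<dots> = real (Suc i) * real q ^ Suc i * (real q)\<^sup>2"
    by (simp add: algebra_simps)
  finally show ?case by (simp only: \<mu>_def)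
qed

lemma exists_frequent_digit_sum:
  assumes "q \<ge> 2" "i \<ge> 1"
  shows "\<exists>j. real q ^ i / (10 * real q * sqrt (real i)) \<le> real (card {n. n < q ^ i \<and> digit_sum q n = j})"
proof (rule ccontr)
  define H where "H = real q ^ i / (10 * real q * sqrt (real i))"
  define \<mu> where "\<mu> = real i * ((real q - 1) / 2)"
  \<comment> \<open>\<open>t\<close> is twice the bound \<open>q * sqrt i\<close> on the standard
    deviation, so Chebyshev leaves at most a quarter outside. The window has at most
    \<open>2 t + 1 <= 5 q sqrt i\<close> integers; with the \<open>10\<close> in \<open>H\<close>
    they account for at most half.\<close>
  define t where "t = 2 * real q * sqrt (real i)"
  \<comment> \<open>\<open>nat\<close> cuts a negative lower end to \<open>0\<close>, which loses no
    digit sum.\<close>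
  define J where "J = {nat \<lceil>\<mu> - t\<rceil>..nat \<lfloor>\<mu> + t\<rfloor>}"
  define A where "A = {n. n < q ^ i \<and> digit_sum q n \<in> J}"
  assume "\<not> ?thesis"
  then have H: "real (card {n. n < q ^ i \<and> digit_sum q n = j}) \<le> H" for j
    by (metis H_def linear)
  have si: "sqrt (real i) \<ge> 1" using assms by simp
  have "1 * 1 \<le> real q * sqrt (real i)"
    using assms si by (intro mult_mono) auto
  then have t1: "2 * t + 1 \<le> 5 * real q * sqrt (real i)"
    by (simp add: t_def)
  have tpos: "t > 0" using assms by (simp add: t_def)
  have \<mu>: "\<mu> \<ge> 0" using assms by (simp add: \<mu>_def)
  have H0: "H \<ge> 0" by (simp add: H_def)
  have "real (card J) \<le> 2 * t + 1"
    unfolding J_def using tpos \<mu> by simp linarith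
  then have cJ: "real (card J) \<le> 5 * real q * sqrt (real i)" using t1 by linarith
  have "A = (\<Union>j\<in>J. {n. n < q ^ i \<and> digit_sum q n = j})" by (auto simp: A_def)
  then have "card A \<le> (\<Sum>j\<in>J. card {n. n < q ^ i \<and> digit_sum q n = j})"
    using card_UN_le[of J "\<lambda>j. {n. n < q ^ i \<and> digit_sum q n = j}"] by (simp add: J_def)
  then have "real (card A) \<le> (\<Sum>j\<in>J. real (card {n. n < q ^ i \<and> digit_sum q n = j}))"
    by (simp flip: of_nat_sum)
  also have "\<dots> \<le> (\<Sum>j\<in>J. H)" by (intro sum_mono H)
  also have "\<dots> = real (card J) * H" by simp
  also have "\<dots> \<le> 5 * real q * sqrt (real i) * H"
    by (intro mult_right_mono cJ H0)
  also have "\<dots> = real q ^ i / 2"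
    using assms by (simp add: H_def field_simps)
  finally have cA: "real (card A) \<le> real q ^ i / 2" .
  define E where "E = {..<q ^ i} - A"
  have "A \<subseteq> {..<q ^ i}" by (auto simp: A_def)
  then have "card E = q ^ i - card A" and "card A \<le> q ^ i"
    using card_mono[of "{..<q ^ i}" A] by (auto simp: E_def card_Diff_subset finite_subset)
  then have cE: "real (card E) = real q ^ i - real (card A)"
    by (simp add: of_nat_diff)
  have far: "t\<^sup>2 \<le> (real (digit_sum q n) - \<mu>)\<^sup>2" if "n \<in> E" for n
  proof -
    have "digit_sum q n \<notin> J" using that by (auto simp: E_def A_def)
    then have "t \<le> \<bar>real (digit_sum q n) - \<mu>\<bar>"
      unfolding J_def by simp linarith
    with tpos show ?thesis by (subst abs_le_square_iff[symmetric]) simp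
  qed
  have "real (card E) * t\<^sup>2 = (\<Sum>n\<in>E. t\<^sup>2)" by simp
  also have "\<dots> \<le> (\<Sum>n\<in>E. (real (digit_sum q n) - \<mu>)\<^sup>2)" by (intro sum_mono far)
  also have "\<dots> \<le> (\<Sum>n<q ^ i. (real (digit_sum q n) - \<mu>)\<^sup>2)"
    by (rule sum_mono2) (auto simp: E_def)
  also have "\<dots> \<le> real i * real q ^ i * (real q)\<^sup>2"
    unfolding \<mu>_def by (rule sum_digit_deviation_sq_le[OF assms(1)])
  also have "\<dots> = real q ^ i / 4 * t\<^sup>2"
    by (simp add: t_def power_mult_distrib)
  finally have "real (card E) \<le> real q ^ i / 4"
    by (rule mult_right_le_imp_le) (use tpos in simp)
  moreover have "real q ^ i > 0" using assms by simp
  \<comment> \<open>\<open>A\<close> and \<open>E\<close> partition the range but cover at most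
    three quarters of it.\<close>
  ultimately show False using cE cA by linarith
qed

section \<open>Basic estimates for the discrepancy\<close>

text \<open>The last bound makes the suprema bounded above, also for \<open>N = 0\<close>, where the
  quotient is \<open>0\<close>.\<close>

lemma local_discrepancy_bounds:
  assumes "\<forall>i<s. 0 \<le> a i \<and> a i \<le> b i \<and> b i \<le> 1"
  shows "0 \<le> box_vol s a b" "box_vol s a b \<le> 1"
    and "\<bar>real (card {n. n < N \<and> y n \<in> box_co s a b}) / real N - box_vol s a b\<bar> \<le> 1"
proof -
  have f: "0 \<le> b i - a i \<and> b i - a i \<le> 1" if "i < s" for i
    using assms[rule_format, OF that] by linarith
  show v: "0 \<le> box_vol s a b" "box_vol s a b \<le> 1"
    unfolding box_vol_def using f by (auto intro!: prod_nonneg prod_le_1)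
  have "card {n. n < N \<and> y n \<in> box_co s a b} \<le> card {..<N}"
    by (rule card_mono) auto
  then have "real (card {n. n < N \<and> y n \<in> box_co s a b}) / real N \<le> 1"
    by (cases "N = 0") (simp_all add: divide_le_eq_1)
  moreover have "0 \<le> real (card {n. n < N \<and> y n \<in> box_co s a b}) / real N"
    by simp
  ultimately show "\<bar>real (card {n. n < N \<and> y n \<in> box_co s a b}) / real N - box_vol s a b\<bar> \<le> 1"
    using v by linarith
qed

lemma discrepancy_upper:
  assumes "\<forall>i<s. 0 \<le> a i \<and> a i \<le> b i \<and> b i \<le> 1"
  shows "\<bar>real (card {n. n < N \<and> y n \<in> box_co s a b}) / real N - box_vol s a b\<bar> \<le> discrepancy s y N"
  unfolding discrepancy_def
  by (rule cSup_upper) (use assms local_discrepancy_bounds(3) in \<open>auto intro!: bdd_aboveI[of _ 1]\<close>)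

lemma discrepancy_least:
  assumes "\<And>a b. \<forall>i<s. 0 \<le> a i \<and> a i \<le> b i \<and> b i \<le> 1 \<Longrightarrow>
    \<bar>real (card {n. n < N \<and> y n \<in> box_co s a b}) / real N - box_vol s a b\<bar> \<le> D"
  shows "discrepancy s y N \<le> D"
proof -
  \<comment> \<open>The unit cube shows that the supremum is over a nonempty set.\<close>
  have "\<exists>a b. \<forall>i<s. 0 \<le> a i \<and> a i \<le> b i \<and> b i \<le> (1::real)"
    by (rule exI[of _ "\<lambda>_. 0"], rule exI[of _ "\<lambda>_. 1"]) simp
  then show ?thesis
    unfolding discrepancy_def by (intro cSup_least) (use assms in blast)+
qed

lemma discrepancy_le_uniform: "discrepancy s X N \<le> uniform_discrepancy s X N"
proof -
  have "discrepancy s (\<lambda>n. X (n + 0)) N \<le> uniform_discrepancy s X N"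
    unfolding uniform_discrepancy_def
    by (rule cSUP_upper)
      (auto intro!: bdd_aboveI[of _ 1] discrepancy_least local_discrepancy_bounds(3))
  then show ?thesis by simp
qed

text \<open>A box that is thin in coordinate \<open>0\<close> contains \<open>p\<close>, and so a
  fraction \<open>w\<close> of the points, but has volume at most \<open>w / 2\<close>.\<close>

lemma discrepancy_ge_frequency:
  assumes "s \<ge> 1" "p \<in> unit_cube s" "w > 0" "w \<le> real (card {n. n < N \<and> y n = p}) / real N"
  shows "w / 2 \<le> discrepancy s y N"
proof -
  \<comment> \<open>The minimum keeps the box inside the unit cube; it is positive because
    \<open>p 0 < 1\<close>.\<close>
  define \<delta> where "\<delta> = min (1 - p 0) (w / 2)"
  define b :: "nat \<Rightarrow> real" where "b = (\<lambda>i. if i = 0 then p 0 + \<delta> else 1)"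
  have p: "0 \<le> p i" "p i < 1" if "i < s" for i
    using assms(2) that by (auto simp: unit_cube_def Pi_iff)
  have \<delta>: "0 < \<delta>" "\<delta> \<le> 1 - p 0" "\<delta> \<le> w / 2"
    unfolding \<delta>_def using assms p[of 0] by (simp_all only: min.cobounded1 min.cobounded2) simp
  have valid: "\<forall>i<s. 0 \<le> p i \<and> p i \<le> b i \<and> b i \<le> 1"
    using p \<delta> by (force simp: b_def intro: less_imp_le)
  have "box_vol s p b = (b 0 - p 0) * (\<Prod>i\<in>{..<s} - {0}. b i - p i)"
    unfolding box_vol_def by (rule prod.remove) (use assms(1) in auto)
  also have "\<dots> \<le> \<delta> * 1"
    using p \<delta> valid by (intro mult_mono prod_le_1 prod_nonneg) (auto simp: b_def)
  finally have vol: "box_vol s p b \<le> w / 2" using \<delta> by simp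
  have "p \<in> box_co s p b"
    using p \<delta> by (auto simp: box_co_def b_def Pi_iff)
  then have "card {n. n < N \<and> y n = p} \<le> card {n. n < N \<and> y n \<in> box_co s p b}"
    by (intro card_mono) auto
  then have "w \<le> real (card {n. n < N \<and> y n \<in> box_co s p b}) / real N"
    using assms(4) by (meson divide_right_mono of_nat_0_le_iff of_nat_le_iff order_trans)
  with vol have "w / 2 \<le> \<bar>real (card {n. n < N \<and> y n \<in> box_co s p b}) / real N - box_vol s p b\<bar>"
    by linarith
  also have "\<dots> \<le> discrepancy s y N" by (rule discrepancy_upper[OF valid])
  finally show ?thesis .
qed

section \<open>Lower bound along the digit sum\<close>

text \<open>In the constant, \<open>10 q\<close> comes from the frequent digit sum, another
  \<open>q\<close> from passing from \<open>q ^ i\<close> to \<open>N\<close>, the factor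
  \<open>2\<close> from the thin box, and \<open>sqrt (ln q)\<close> from
  \<open>i ln q <= ln N\<close>.\<close>

lemma discrepancy_digit_sum_ge:
  assumes "q \<ge> 2" "s \<ge> 1" "\<And>n. X n \<in> unit_cube s" "N \<ge> q"
  shows "sqrt (ln (real q)) / (20 * (real q)\<^sup>2) / sqrt (ln (real N))
    \<le> discrepancy s (\<lambda>n. X (digit_sum q n)) N"
proof -
  obtain i where i: "q ^ i \<le> N" "N < q ^ (i + 1)"
    using ex_power_ivl1[of q N] assms by auto
  have "i \<noteq> 0" using i assms by (intro notI) simp
  then have i1: "i \<ge> 1" by simp
  have N: "N > 0" and lnN: "ln (real N) > 0" and lnq: "ln (real q) > 0" using assms by auto
  obtain j where j: "real q ^ i / (10 * real q * sqrt (real i)) \<le> real (card {n. n < q ^ i \<and> digit_sum q n = j})"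
    using exists_frequent_digit_sum[OF assms(1) i1] by blast
  define w where "w = sqrt (ln (real q)) / (10 * (real q)\<^sup>2) / sqrt (ln (real N))"
  have "w > 0" using lnN lnq assms by (simp add: w_def)
  have "real i * ln (real q) = ln (real q ^ i)" using assms by (simp add: ln_realpow)
  also have "\<dots> \<le> ln (real N)"
    using i(1) N assms by (subst ln_le_cancel_iff) (simp_all flip: of_nat_power)
  finally have "sqrt (real i) * sqrt (ln (real q)) \<le> sqrt (ln (real N))"
    by (simp flip: real_sqrt_mult)
  then have si: "sqrt (ln (real q)) / sqrt (ln (real N)) \<le> 1 / sqrt (real i)"
    using lnN i1 by (simp add: field_simps)
  have Nq: "real N \<le> real q * real q ^ i"
    using i(2) by (simp flip: of_nat_power of_nat_mult)
  have "real N * w = real N * (sqrt (ln (real q)) / sqrt (ln (real N))) / (10 * (real q)\<^sup>2)"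
    by (simp add: w_def)
  also have "\<dots> \<le> real q * real q ^ i * (1 / sqrt (real i)) / (10 * (real q)\<^sup>2)"
    using lnN lnq by (intro divide_right_mono mult_mono Nq si) simp_all
  also have "\<dots> = real q ^ i / (10 * real q * sqrt (real i))"
    using assms by (simp add: power2_eq_square)
  also note j
  \<comment> \<open>Other digit sums may hit the same point \<open>X j\<close>, which only raises
    the count.\<close>
  also have "card {n. n < q ^ i \<and> digit_sum q n = j} \<le> card {n. n < N \<and> X (digit_sum q n) = X j}"
    using i(1) by (intro card_mono) auto
  finally have "w \<le> real (card {n. n < N \<and> X (digit_sum q n) = X j}) / real N"
    using N by (simp add: field_simps)
  from discrepancy_ge_frequency[OF assms(2) assms(3) \<open>w > 0\<close> this] show ?thesis
    by (simp add: w_def)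
qed

section \<open>Upper bound along the digit sum\<close>

text \<open>The increments of the unnormalised local discrepancy \<open>F\<close> of
  \<open>X\<close> are centred indicators of the box. Summed at the digit sums they give the local
  discrepancy of the new sequence, to which Abel summation applies.\<close>

lemma discrepancy_digit_sum_le:
  assumes "q \<ge> 2" "C > 0"
    and X: "\<And>m. m \<ge> 2 \<Longrightarrow> real m * uniform_discrepancy s X m \<le> C * ln (real m) ^ s"
    and i: "q ^ (2 * i) \<le> N" "N < q ^ (2 * Suc i)"
  shows "discrepancy s (\<lambda>n. X (digit_sum q n)) N
    \<le> (2 * sqrt (real q / 2) + 2) * (C * ln (real (Suc (2 * q * Suc i))) ^ s + 1) / sqrt (real (Suc i))"
proof (rule discrepancy_least)
  fix a b :: "nat \<Rightarrow> real"
  assume ab: "\<forall>i<s. 0 \<le> a i \<and> a i \<le> b i \<and> b i \<le> 1"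
  \<comment> \<open>\<open>J\<close> bounds the digit sums below \<open>N\<close>. The
    \<open>+ 1\<close> in \<open>B\<close> covers \<open>F 0\<close> and \<open>F 1\<close>, where
    the hypothesis on \<open>X\<close> says nothing.\<close>
  define J B where "J = 2 * q * Suc i" and "B = C * ln (real (Suc J)) ^ s + 1"
  define F where "F j = real (card {n. n < j \<and> X n \<in> box_co s a b}) - real j * box_vol s a b" for j
  have N: "N > 0" using i(1) assms(1) by (metis le_0_eq not_gr0 power_not_zero not_numeral_le_zero)
  have u: "digit_sum q n \<le> J" if "n < N" for n
    using digit_sum_le[of q n "2 * Suc i"] that i(2) assms(1) by (simp add: J_def mult_ac)
  have B: "B \<ge> 1" using assms(2) by (simp add: B_def)
  have F: "\<bar>F j\<bar> \<le> B" if "j \<le> Suc J" for j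
  proof (cases "j \<ge> 2")
    case True
    have "\<bar>F j\<bar> = real j * \<bar>real (card {n. n < j \<and> X n \<in> box_co s a b}) / real j - box_vol s a b\<bar>"
      using True by (simp add: F_def abs_mult_pos' field_simps)
    also have "\<dots> \<le> real j * uniform_discrepancy s X j"
      by (intro mult_left_mono order_trans[OF discrepancy_upper[OF ab] discrepancy_le_uniform]) simp
    also have "\<dots> \<le> C * ln (real j) ^ s" by (rule X[OF True])
    also have "\<dots> \<le> C * ln (real (Suc J)) ^ s"
      using True that assms(2) by (intro mult_left_mono power_mono) auto
    finally show ?thesis by (simp add: B_def)
  next
    case False
    then consider "j = 0" | "j = 1" by linarith
    then show ?thesis
    proof cases
      case 2
      then show ?thesis
        using B local_discrepancy_bounds(3)[OF ab, of 1 X] by (simp add: F_def)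
    qed (use B in \<open>simp add: F_def\<close>)
  qed
  have dF: "F (Suc j) - F j = of_bool (X j \<in> box_co s a b) - box_vol s a b" for j
  proof -
    have "{n. n < Suc j \<and> X n \<in> box_co s a b}
        = {n. n < j \<and> X n \<in> box_co s a b} \<union> (if X j \<in> box_co s a b then {j} else {})"
      by (auto simp: less_Suc_eq)
    then show ?thesis by (simp add: F_def algebra_simps)
  qed
  have "{n. n < N \<and> X (digit_sum q n) \<in> box_co s a b} = {..<N} \<inter> {n. X (digit_sum q n) \<in> box_co s a b}"
    by auto
  then have count: "real (card {n. n < N \<and> X (digit_sum q n) \<in> box_co s a b})
      = (\<Sum>n<N. of_bool (X (digit_sum q n) \<in> box_co s a b))"
    by (simp only: sum_of_bool_eq finite_lessThan)
  have "real N * \<bar>real (card {n. n < N \<and> X (digit_sum q n) \<in> box_co s a b}) / real N - box_vol s a b\<bar>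
      = \<bar>real (card {n. n < N \<and> X (digit_sum q n) \<in> box_co s a b}) - real N * box_vol s a b\<bar>"
    using N by (simp add: abs_mult_pos' field_simps)
  also have "\<dots> = \<bar>\<Sum>n<N. F (Suc (digit_sum q n)) - F (digit_sum q n)\<bar>"
    by (simp only: count dF sum_subtractf sum_constant card_lessThan)
  also have "\<dots> \<le> l1_norm ([:1, -1:] * digit_sum_poly q N) * B"
    unfolding digit_sum_poly_def by (rule abs_sum_difference_le_l1_norm[OF u F])
  also have "\<dots> \<le> (2 * sqrt (real q / 2) + 2) * (real N / sqrt (real (Suc i))) * B"
    using B by (intro mult_right_mono l1_norm_diff_digit_sum_poly_le assms i) simp
  also have "\<dots> = real N * ((2 * sqrt (real q / 2) + 2) * B / sqrt (real (Suc i)))"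
    by simp
  finally show "\<bar>real (card {n. n < N \<and> X (digit_sum q n) \<in> box_co s a b}) / real N - box_vol s a b\<bar>
      \<le> (2 * sqrt (real q / 2) + 2) * (C * ln (real (Suc (2 * q * Suc i))) ^ s + 1) / sqrt (real (Suc i))"
    using N unfolding B_def J_def by (subst (asm) mult_le_cancel_left_pos) simp_all
qed

text \<open>With \<open>L = ln N\<close>, the index \<open>i + 1\<close> is at least
  \<open>L / (2 ln q)\<close>, and the argument of the inner logarithm is at most
  \<open>L^2\<close>, whence \<open>2 ^ s\<close>. The condition \<open>L >= 5 q\<close> serves the
  latter; \<open>ln L >= 1\<close> absorbs the \<open>+ 1\<close>.\<close>

lemma discrepancy_digit_sum_le_ln:
  assumes "q \<ge> 2" "C > 0"
    and X: "\<And>m. m \<ge> 2 \<Longrightarrow> real m * uniform_discrepancy s X m \<le> C * ln (real m) ^ s"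
    and N: "ln (real N) \<ge> 5 * real q" "ln (ln (real N)) \<ge> 1"
  shows "discrepancy s (\<lambda>n. X (digit_sum q n)) N
    \<le> (2 * sqrt (real q / 2) + 2) * (C * 2 ^ s + 1) * sqrt (2 * ln (real q)) * (ln (ln (real N)) ^ s / sqrt (ln (real N)))"
proof -
  define L where "L = ln (real N)"
  have L: "L \<ge> 5 * real q" "ln L \<ge> 1" and L10: "L \<ge> 10" using N assms(1) by (simp_all add: L_def)
  \<comment> \<open>As \<open>ln 0 = 0\<close> by convention, \<open>L >= 10\<close> excludes
    \<open>N = 0\<close>.\<close>
  have N1: "N \<ge> 1"
    using L10 by (cases N) (simp_all add: L_def)
  \<comment> \<open>Base \<open>q^2\<close> locates \<open>N\<close> between consecutive even powers
    of \<open>q\<close>.\<close>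
  have "(2::nat) \<le> q\<^sup>2" using assms(1) self_le_power[of q 2] by simp
  from ex_power_ivl1[OF this N1] obtain i where "(q\<^sup>2) ^ i \<le> N" "N < (q\<^sup>2) ^ (i + 1)" by blast
  then have i: "q ^ (2 * i) \<le> N" "N < q ^ (2 * Suc i)"
    by (simp_all only: power_mult Suc_eq_plus1)
  \<comment> \<open>Combined with \<open>2 i ln q <= L\<close> this yields
    \<open>i <= L\<close>.\<close>
  have "1/2 \<le> ln (2::real)" using ln_ge_iff[of 2 "1/2"] exp_half_le2 by simp
  also have "\<dots> \<le> ln (real q)" using assms(1) by simp
  finally have lnq: "ln (real q) \<ge> 1/2" .
  have "real (2 * i) * ln (real q) = ln (real q ^ (2 * i))"
    using assms(1) by (simp only: ln_realpow)
  also have "\<dots> \<le> L"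
    unfolding L_def using i(1) N1 assms(1) by (subst ln_le_cancel_iff) (simp_all flip: of_nat_power)
  finally have "real (2 * i) * ln (real q) \<le> L" .
  moreover have "real (2 * i) * (1/2) \<le> real (2 * i) * ln (real q)"
    by (intro mult_left_mono lnq) simp
  ultimately have iL: "real i \<le> L" by simp
  have "real N \<le> real q ^ (2 * Suc i)"
    using less_imp_le[OF i(2)] by (simp only: of_nat_power[symmetric] of_nat_le_iff)
  then have "L \<le> ln (real q ^ (2 * Suc i))"
    unfolding L_def using N1 by (intro ln_mono) simp_all
  also have "\<dots> = 2 * ln (real q) * real (Suc i)"
    using assms(1) by (subst ln_realpow) simp_all
  finally have "sqrt L \<le> sqrt (2 * ln (real q)) * sqrt (real (Suc i))"
    by (simp only: real_sqrt_mult[symmetric] real_sqrt_le_iff)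
  then have si: "1 / sqrt (real (Suc i)) \<le> sqrt (2 * ln (real q)) / sqrt L"
    using L10 by (simp add: field_simps)
  have "real (Suc (2 * q * Suc i)) = 2 * real q * (real i + 1) + 1" by (simp add: algebra_simps)
  also have "\<dots> \<le> 2 * real q * (L + 1) + 1"
    using iL by (intro add_right_mono mult_left_mono) simp_all
  also have "\<dots> \<le> 5 * real q * L"
  proof -
    have "2 * 10 \<le> real q * L" using assms(1) L10 by (intro mult_mono) simp_all
    moreover have "real q * 10 \<le> real q * L" using L10 by (intro mult_left_mono) simp_all
    ultimately show ?thesis by (simp add: algebra_simps)
  qed
  also have "\<dots> \<le> L\<^sup>2"
    using L L10 by (simp add: power2_eq_square)
  finally have "ln (real (Suc (2 * q * Suc i))) \<le> ln (L\<^sup>2)"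
    by (intro ln_mono) (simp_all only: of_nat_0_less_iff zero_less_Suc)
  also have "\<dots> = 2 * ln L" using L10 by (simp add: ln_realpow)
  finally have "C * ln (real (Suc (2 * q * Suc i))) ^ s + 1 \<le> C * (2 * ln L) ^ s + ln L ^ s"
    using assms(2) L by (intro add_mono mult_left_mono power_mono one_le_power) simp_all
  also have "\<dots> = (C * 2 ^ s + 1) * ln L ^ s"
    by (simp add: power_mult_distrib algebra_simps)
  finally have B: "C * ln (real (Suc (2 * q * Suc i))) ^ s + 1 \<le> (C * 2 ^ s + 1) * ln L ^ s" .
  have "discrepancy s (\<lambda>n. X (digit_sum q n)) N
    \<le> (2 * sqrt (real q / 2) + 2) * (C * ln (real (Suc (2 * q * Suc i))) ^ s + 1) / sqrt (real (Suc i))"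
    by (rule discrepancy_digit_sum_le[OF assms(1,2) X i])
  also have "\<dots> = (2 * sqrt (real q / 2) + 2) * (C * ln (real (Suc (2 * q * Suc i))) ^ s + 1) * (1 / sqrt (real (Suc i)))"
    by simp
  also have "\<dots> \<le> (2 * sqrt (real q / 2) + 2) * ((C * 2 ^ s + 1) * ln L ^ s) * (sqrt (2 * ln (real q)) / sqrt L)"
    using assms(2) L by (intro mult_mono B si order_refl mult_nonneg_nonneg) simp_all
  finally show ?thesis by (simp add: L_def mult_ac)
qed

theorem theorem2:
  fixes q :: nat
  assumes "q \<ge> 2"
  shows "\<exists>c2::real. c2 > 0 \<and>
    (\<forall>(s::nat) (X :: nat \<Rightarrow> nat \<Rightarrow> real).
       s \<ge> 1 \<longrightarrow>
       (\<forall>n. X n \<in> unit_cube s) \<longrightarrow>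
       (\<exists>C::real. C > 0 \<and>
          (\<forall>m::nat. m \<ge> 2 \<longrightarrow> real m * uniform_discrepancy s X m \<le> C * ln (real m) ^ s)) \<longrightarrow>
       (\<exists>c3::real. c3 > 0 \<and>
          (\<forall>\<^sub>F N in sequentially.
             c2 / sqrt (ln (real N)) \<le> discrepancy s (\<lambda>n. X (digit_sum q n)) N \<and>
             discrepancy s (\<lambda>n. X (digit_sum q n)) N
               \<le> c3 * (ln (ln (real N)) ^ s / sqrt (ln (real N))))))"
\<comment> \<open>The witness is the constant of \<open>discrepancy_digit_sum_ge\<close>, fixed
  before \<open>s\<close> and \<open>X\<close>.\<close>
proof (rule exI[of _ "sqrt (ln (real q)) / (20 * (real q)\<^sup>2)"], intro conjI allI impI)
  show "0 < sqrt (ln (real q)) / (20 * (real q)\<^sup>2)" using assms by simp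
next
  fix s :: nat and X :: "nat \<Rightarrow> nat \<Rightarrow> real"
  assume s: "s \<ge> 1" and X: "\<forall>n. X n \<in> unit_cube s"
    and "\<exists>C::real. C > 0 \<and> (\<forall>m::nat. m \<ge> 2 \<longrightarrow> real m * uniform_discrepancy s X m \<le> C * ln (real m) ^ s)"
  then obtain C :: real where C: "C > 0"
    "\<And>m::nat. m \<ge> 2 \<Longrightarrow> real m * uniform_discrepancy s X m \<le> C * ln (real m) ^ s" by blast
  define c3 where "c3 = (2 * sqrt (real q / 2) + 2) * (C * 2 ^ s + 1) * sqrt (2 * ln (real q))"
  have "c3 > 0"
    using assms C(1) unfolding c3_def by (intro mult_pos_pos add_nonneg_pos) simp_all
  have ln: "LIM N sequentially. ln (real N) :> at_top"
    by (rule filterlim_compose[OF ln_at_top filterlim_real_sequentially])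
  then have "\<forall>\<^sub>F N in sequentially. ln (real N) \<ge> 5 * real q"
    by (simp add: filterlim_at_top)
  moreover from filterlim_compose[OF ln_at_top ln]
  have "\<forall>\<^sub>F N in sequentially. ln (ln (real N)) \<ge> 1"
    by (simp add: filterlim_at_top)
  moreover have "\<forall>\<^sub>F N in sequentially. N \<ge> q"
    by (rule eventually_ge_at_top)
  ultimately have "\<forall>\<^sub>F N in sequentially.
      sqrt (ln (real q)) / (20 * (real q)\<^sup>2) / sqrt (ln (real N)) \<le> discrepancy s (\<lambda>n. X (digit_sum q n)) N \<and>
      discrepancy s (\<lambda>n. X (digit_sum q n)) N \<le> c3 * (ln (ln (real N)) ^ s / sqrt (ln (real N)))"
    unfolding c3_def
    by eventually_elim
      (use assms s X C in \<open>intro conjI discrepancy_digit_sum_ge discrepancy_digit_sum_le_ln; blast\<close>)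
  with \<open>c3 > 0\<close> show "\<exists>c3>0. \<forall>\<^sub>F N in sequentially.
      sqrt (ln (real q)) / (20 * (real q)\<^sup>2) / sqrt (ln (real N)) \<le> discrepancy s (\<lambda>n. X (digit_sum q n)) N \<and>
      discrepancy s (\<lambda>n. X (digit_sum q n)) N \<le> c3 * (ln (ln (real N)) ^ s / sqrt (ln (real N)))"
    by blast
qed

end
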